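(* Let $\widehat E=E+\varepsilon E_0$ and $\widehat F=F+\varepsilon F_0$ be dual matrices in $\mathbb{D}^{m\times n}$ whose dual Moore-Penrose generalized inverses (DMPGIs) exist. Then $\widehat E\overset{{\rm D}\text{-}\ast}{\leq}\widehat F$ (D-star partial order) if and only if $\widehat E\overset{{\rm DM}\text{-}\ast}{\leq}\widehat F$ (Dual-minus star partial order) and $$EE^\dagger(F_0-E_0)=(E^{T})^\dagger E_0^{T}(E-F),\qquad (F_0-E_0)E^\dagger E=(E-F)E_0^{T}(E^{T})^\dagger.$$
   Context: $\varepsilon$ is the dual unit: $\varepsilon\neq 0$, $\varepsilon^2=0$, commuting with reals. $\mathbb{D}^{m\times n}$ is the set of $m\times n$ dual matrices $\widehat E=E+\varepsilon E_0$ with $E,E_0\in\mathbb{R}^{m\times n}$, with the obvious addition, multiplication and transpose $\widehat E^{T}=E^T+\varepsilon E_0^T$. The DMPGI of $\widehat E\in\mathbb{D}^{m\times n}$ is the unique $\widehat X\in\mathbb{D}^{n\times m}$, if it exists, with $\widehat E\widehat X\widehat E=\widehat E$, $\widehat X\widehat E\widehat X=\widehat X$, $(\widehat E\widehat X)^T=\widehat E\widehat X$, $(\widehat X\widehat E)^T=\widehat X\widehat E$. For a real matrix $E$, $E^\dagger$ is the usual Moore-Penrose inverse. Star partial order on real $m\times n$ matrices: $E\overset{\ast}{\leq}F$ means $E^{T}E=E^{T}F$ and $EE^{T}=FE^{T}$. For $\widehat E,\widehat F\in\mathbb{D}^{m\times n}$ whose DMPGIs exist: (i) Dual-minus star partial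 order: $\widehat E\overset{{\rm DM}\text{-}\ast}{\leq}\widehat F$ means that $E\overset{\ast}{\leq}F$ and the DMPGI of $\widehat F-\widehat E$ exists. (ii) D-star partial order: $\widehat E\overset{{\rm D}\text{-}\ast}{\leq}\widehat F$ means $\widehat E^{T}\widehat E=\widehat E^{T}\widehat F$ and $\widehat E\widehat E^{T}=\widehat F\widehat E^{T}$. *)

theory Defs
  imports "HOL-Analysis.Analysis"
begin

section \<open>Dual numbers\<close>

datatype dual = Dual (std_part: real) (inf_part: real)

lemma dual_eq_iff: "x = y \<longleftrightarrow> std_part x = std_part y \<and> inf_part x = inf_part y"
  by (cases x; cases y) auto

instantiation dual :: "{comm_ring_1, real_algebra_1}"
begin

definition "0 = Dual 0 0"
definition "1 = Dual 1 0"
definition "x + y = Dual (std_part x + std_part y) (inf_part x + inf_part y)"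
definition "- x = Dual (- std_part x) (- inf_part x)"
definition "x - y = Dual (std_part x - std_part y) (inf_part x - inf_part y)"
definition "x * y =
  Dual (std_part x * std_part y) (std_part x * inf_part y + inf_part x * std_part y)"
definition "scaleR r x = Dual (r * std_part x) (r * inf_part x)"

instance
  by standard
    (simp_all add: zero_dual_def one_dual_def plus_dual_def uminus_dual_def minus_dual_def
      times_dual_def scaleR_dual_def algebra_simps)

end

definition dual_unit :: dual where
  "dual_unit = Dual 0 1"

lemma dual_unit_nonzero: "dual_unit \<noteq> 0"
  by (simp add: dual_unit_def zero_dual_def)

lemma dual_unit_square: "dual_unit ^ 2 = 0"
  by (simp add: power2_eq_square dual_unit_def zero_dual_def times_dual_def)

lemma of_real_dual: "of_real a = Dual a 0"
  by (simp add: of_real_def scaleR_dual_def one_dual_def)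

lemma Dual_eq: "Dual a b = of_real a + dual_unit * of_real b"
  by (simp add: of_real_dual dual_unit_def plus_dual_def times_dual_def)

section \<open>Dual matrices\<close>

text \<open>\<^term>\<open>dual_matrix E E0\<close> is the dual matrix usually written as E + \<epsilon> E0. Sum, difference,
  product and transpose of dual matrices are the library operations at entry type \<^typ>\<open>dual\<close>.\<close>

definition dual_matrix :: "real ^ 'n ^ 'm \<Rightarrow> real ^ 'n ^ 'm \<Rightarrow> dual ^ 'n ^ 'm" where
  "dual_matrix E E0 = (\<chi> i j. of_real (E $ i $ j) + dual_unit * of_real (E0 $ i $ j))"

definition std_matrix :: "dual ^ 'n ^ 'm \<Rightarrow> real ^ 'n ^ 'm" where
  "std_matrix = map_matrix std_part"

definition inf_matrix :: "dual ^ 'n ^ 'm \<Rightarrow> real ^ 'n ^ 'm" where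
  "inf_matrix = map_matrix inf_part"

lemma std_matrix_dual_matrix [simp]: "std_matrix (dual_matrix E E0) = E"
  by (simp add: std_matrix_def dual_matrix_def vec_eq_iff flip: Dual_eq)

lemma inf_matrix_dual_matrix [simp]: "inf_matrix (dual_matrix E E0) = E0"
  by (simp add: inf_matrix_def dual_matrix_def vec_eq_iff flip: Dual_eq)

lemma dual_matrix_parts [simp]: "dual_matrix (std_matrix A) (inf_matrix A) = A"
  by (simp add: std_matrix_def inf_matrix_def dual_matrix_def vec_eq_iff flip: Dual_eq)

lemma dual_matrix_add:
  "dual_matrix E E0 + dual_matrix F F0 = dual_matrix (E + F) (E0 + F0)"
  by (simp add: dual_matrix_def vec_eq_iff algebra_simps)

lemma dual_matrix_mult:
  "dual_matrix E E0 ** dual_matrix F F0 = dual_matrix (E ** F) (E ** F0 + E0 ** F)"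
proof -
  have "(of_real a + dual_unit * of_real b) * (of_real c + dual_unit * of_real d) =
      of_real (a * c) + dual_unit * of_real (a * d + b * c)" for a b c d :: real
    by (simp add: of_real_dual dual_unit_def plus_dual_def times_dual_def)
  then show ?thesis
    by (simp add: dual_matrix_def matrix_matrix_mult_def vec_eq_iff sum.distrib sum_distrib_left
        distrib_left)
qed

lemma dual_matrix_transpose:
  "transpose (dual_matrix E E0) = dual_matrix (transpose E) (transpose E0)"
  by (simp add: dual_matrix_def transpose_def vec_eq_iff)

section \<open>Moore-Penrose inverses\<close>

text \<open>The four Penrose equations, used both for real and for dual matrices.\<close>

definition is_mp_inverse :: "'a::comm_ring_1 ^ 'n ^ 'm \<Rightarrow> 'a ^ 'm ^ 'n \<Rightarrow> bool" where
  "is_mp_inverse A X \<longleftrightarrow>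
     A ** X ** A = A \<and> X ** A ** X = X \<and>
     transpose (A ** X) = A ** X \<and> transpose (X ** A) = X ** A"

lemma is_mp_inverse_unique:
  assumes "is_mp_inverse A X" "is_mp_inverse A Y"
  shows "X = Y"
proof -
  have 1: "A ** X = A ** Y"
  proof -
    have "A ** X = transpose (A ** Y ** (A ** X))"
      using assms by (metis is_mp_inverse_def matrix_mul_assoc)
    also have "\<dots> = transpose (A ** X) ** transpose (A ** Y)"
      by (rule matrix_transpose_mul)
    also have "\<dots> = A ** Y"
      using assms by (metis is_mp_inverse_def matrix_mul_assoc)
    finally show ?thesis .
  qed
  have 2: "X ** A = Y ** A"
  proof -
    have "X ** A = transpose (X ** A ** (Y ** A))"
      using assms by (metis is_mp_inverse_def matrix_mul_assoc)
    also have "\<dots> = transpose (Y ** A) ** transpose (X ** A)"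
      by (rule matrix_transpose_mul)
    also have "\<dots> = Y ** A"
      using assms by (metis is_mp_inverse_def matrix_mul_assoc)
    finally show ?thesis .
  qed
  show ?thesis
    using assms 1 2 by (metis is_mp_inverse_def matrix_mul_assoc)
qed

definition mp_inverse :: "real ^ 'n ^ 'm \<Rightarrow> real ^ 'm ^ 'n" where
  "mp_inverse A = (THE X. is_mp_inverse A X)"

definition has_DMPGI :: "dual ^ 'n ^ 'm \<Rightarrow> bool" where
  "has_DMPGI A \<longleftrightarrow> (\<exists>!X. is_mp_inverse A X)"

lemma has_DMPGI_iff: "has_DMPGI A \<longleftrightarrow> (\<exists>X. is_mp_inverse A X)"
  unfolding has_DMPGI_def using is_mp_inverse_unique by blast

section \<open>Partial orders\<close>

definition star_le :: "real ^ 'n ^ 'm \<Rightarrow> real ^ 'n ^ 'm \<Rightarrow> bool" where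
  "star_le E F \<longleftrightarrow>
     transpose E ** E = transpose E ** F \<and> E ** transpose E = F ** transpose E"

text \<open>The next two relations are intended for matrices whose DMPGIs exist; that requirement is
  not part of the definitions and has to be assumed where they are used.\<close>

definition DM_star_le :: "dual ^ 'n ^ 'm \<Rightarrow> dual ^ 'n ^ 'm \<Rightarrow> bool" where
  "DM_star_le E F \<longleftrightarrow> star_le (std_matrix E) (std_matrix F) \<and> has_DMPGI (F - E)"

definition D_star_le :: "dual ^ 'n ^ 'm \<Rightarrow> dual ^ 'n ^ 'm \<Rightarrow> bool" where
  "D_star_le E F \<longleftrightarrow>
     transpose E ** E = transpose E ** F \<and> E ** transpose E = F ** transpose E"

end

theory Submission
  imports Defs
begin

text \<open>Put G = F - E, with dual part G0 = F0 - E0. The D-star equations say that the dual matrices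
  of E and G annihilate each other from both sides after transposition. This relation
  alone gives, over any commutative ring, that the difference of the Moore-Penrose inverses of F and
  E is a Moore-Penrose inverse of G, so the DMPGI of the difference exists. The dual parts read
  E^T G0 = - E0^T G and G0 E^T = - G E0^T; multiplying by the transposed Moore-Penrose inverse of E
  gives the two stated equations. Multiplying back by E^T loses the term (1 - X E) E0^T G,
  X being the Moore-Penrose inverse of E, which vanishes because G = (1 - E X) G and existence of
  the DMPGI forces (1 - E X) E0 (1 - X E) = 0.\<close>

lemma matrix_add_rdistrib:
  fixes A B :: "'a::comm_ring_1 ^ 'n ^ 'm" and C :: "'a ^ 'p ^ 'n"
  shows "(A + B) ** C = A ** C + B ** C"
  by (simp add: matrix_matrix_mult_def vec_eq_iff distrib_right sum.distrib)

lemma matrix_mul_lzero: "0 ** A = (0 :: 'a::comm_ring_1 ^ 'p ^ 'm)"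
  by (simp add: matrix_matrix_mult_def vec_eq_iff)

lemma matrix_mul_rzero: "A ** 0 = (0 :: 'a::comm_ring_1 ^ 'p ^ 'm)"
  by (simp add: matrix_matrix_mult_def vec_eq_iff)

lemma matrix_diff_left:
  fixes A B :: "'a::comm_ring_1 ^ 'n ^ 'm" and C :: "'a ^ 'p ^ 'n"
  shows "(A - B) ** C = A ** C - B ** C"
  by (simp add: matrix_matrix_mult_def vec_eq_iff left_diff_distrib sum_subtractf)

lemma matrix_diff_right:
  fixes A :: "'a::comm_ring_1 ^ 'n ^ 'm" and B C :: "'a ^ 'p ^ 'n"
  shows "A ** (B - C) = A ** B - A ** C"
  by (simp add: matrix_matrix_mult_def vec_eq_iff right_diff_distrib sum_subtractf)

lemma transpose_diff:
  fixes A B :: "'a::comm_ring_1 ^ 'n ^ 'm"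
  shows "transpose (A - B) = transpose A - transpose B"
  by (simp add: transpose_def vec_eq_iff)

lemma dual_matrix_diff:
  "dual_matrix E E0 - dual_matrix F F0 = dual_matrix (E - F) (E0 - F0)"
  by (simp add: dual_matrix_def vec_eq_iff algebra_simps)

lemma dual_matrix_eq_iff:
  "dual_matrix E E0 = dual_matrix F F0 \<longleftrightarrow> E = F \<and> E0 = F0"
  by (metis std_matrix_dual_matrix inf_matrix_dual_matrix)

lemma mp_inverse_eqI: "is_mp_inverse A X \<Longrightarrow> mp_inverse A = X"
  unfolding mp_inverse_def using is_mp_inverse_unique by blast

lemma is_mp_inverse_transpose:
  assumes "is_mp_inverse A X"
  shows "is_mp_inverse (transpose A) (transpose X)"
  using assms unfolding is_mp_inverse_def
  by (metis matrix_transpose_mul matrix_mul_assoc)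

text \<open>Symmetry of A X and X A gives, for instance, A^T A X = (A X A)^T. The last two
  identities make X a multiple of A^T from either side, so that equations about A^T become equations
  about X.\<close>

lemma is_mp_inverse_transpose_factor:
  assumes "is_mp_inverse A X"
  shows "transpose A ** A ** X = transpose A"
    and "X ** A ** transpose A = transpose A"
    and "X ** transpose X ** transpose A = X"
    and "transpose A ** transpose X ** X = X"
  using assms unfolding is_mp_inverse_def
  by (metis matrix_transpose_mul matrix_mul_assoc)+

text \<open>The star relations apply once X is written as X X^T E^T or as E^T X^T X.\<close>

lemma star_le_mp_inverse_mult:
  assumes E: "is_mp_inverse E X"
    and le: "transpose E ** E = transpose E ** F" "E ** transpose E = F ** transpose E"
  shows "X ** F = X ** E" and "F ** X = E ** X"
  using is_mp_inverse_transpose_factor[OF E] le by (metis matrix_mul_assoc)+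

text \<open>The transposed relations give E^T = X E F^T = F^T E X, and F^T is unchanged by F Y on
  its right and by Y F on its left. So E^T, and with it X, is unchanged too.\<close>

lemma star_le_mp_inverse_absorb:
  assumes E: "is_mp_inverse E X" and F: "is_mp_inverse F Y"
    and le: "transpose E ** E = transpose E ** F" "E ** transpose E = F ** transpose E"
  shows "X ** F ** Y = X" and "Y ** F ** X = X"
proof -
  note E' = is_mp_inverse_transpose_factor[OF E] and F' = is_mp_inverse_transpose_factor[OF F]
  have l: "transpose E ** E = transpose F ** E"
    using arg_cong[OF le(1), of transpose] by (simp add: matrix_transpose_mul)
  have r: "E ** transpose E = E ** transpose F"
    using arg_cong[OF le(2), of transpose] by (simp add: matrix_transpose_mul)
  have "transpose E ** F ** Y = X ** E ** transpose F ** F ** Y"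
    using E'(2) r by (metis matrix_mul_assoc)
  also have "\<dots> = transpose E"
    using E'(2) F'(1) r by (metis matrix_mul_assoc)
  finally show "X ** F ** Y = X"
    using E'(3) by (metis matrix_mul_assoc)
  have "Y ** F ** transpose E = Y ** F ** transpose F ** E ** X"
    using E'(1) l by (metis matrix_mul_assoc)
  also have "\<dots> = transpose E"
    using E'(1) F'(2) l by (metis matrix_mul_assoc)
  finally show "Y ** F ** X = X"
    using E'(4) by (metis matrix_mul_assoc)
qed

text \<open>The mixed products collapse to E X and X E. Both products of the differences are then
  differences of symmetric idempotents, F Y - E X and Y F - X E.\<close>

lemma is_mp_inverse_star_le_diff:
  assumes E: "is_mp_inverse E X" and F: "is_mp_inverse F Y"
    and le: "transpose E ** E = transpose E ** F" "E ** transpose E = F ** transpose E"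
  shows "is_mp_inverse (F - E) (Y - X)"
proof -
  have XF: "X ** F = X ** E" and FX: "F ** X = E ** X"
    using star_le_mp_inverse_mult[OF E le] .
  have XFY: "X ** F ** Y = X" and YFX: "Y ** F ** X = X"
    using star_le_mp_inverse_absorb[OF E F le] .
  have EXE: "E ** X ** E = E" "X ** E ** X = X"
    "transpose (E ** X) = E ** X" "transpose (X ** E) = X ** E"
    using E by (auto simp: is_mp_inverse_def)
  have FYF: "F ** Y ** F = F" "Y ** F ** Y = Y"
    "transpose (F ** Y) = F ** Y" "transpose (Y ** F) = Y ** F"
    using F by (auto simp: is_mp_inverse_def)
  \<comment> \<open>E Y = E X E Y = E X F Y = E X; the next fact is its mirror image.\<close>
  have EY: "E ** Y = E ** X"
    using EXE(1) XF XFY by (metis matrix_mul_assoc)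
  have YE: "Y ** E = X ** E"
    using EXE(1) FX YFX by (metis matrix_mul_assoc)
  have FE: "(F - E) ** (Y - X) = F ** Y - E ** X"
    by (simp add: matrix_diff_left matrix_diff_right FX EY)
  have YX: "(Y - X) ** (F - E) = Y ** F - X ** E"
    by (simp add: matrix_diff_left matrix_diff_right XF YE)
  have "F ** Y ** E = E" "E ** X ** F = E"
    using YE FX XF EXE(1) by (metis matrix_mul_assoc)+
  then have 1: "(F - E) ** (Y - X) ** (F - E) = F - E"
    unfolding FE by (simp add: matrix_diff_left matrix_diff_right FYF EXE)
  have "X ** E ** Y = X"
    using EY EXE(2) by (metis matrix_mul_assoc)
  then have 2: "(Y - X) ** (F - E) ** (Y - X) = Y - X"
    unfolding YX by (simp add: matrix_diff_left matrix_diff_right FYF EXE YFX)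
  show ?thesis
    unfolding is_mp_inverse_def using 1 2 FYF(3,4) EXE(3,4)
    by (simp add: FE YX transpose_diff)
qed

text \<open>Taking standard parts respects products and transposes. This supplies a real
  Moore-Penrose inverse of E from the assumed DMPGI.\<close>

lemma is_mp_inverse_std_matrix:
  assumes "is_mp_inverse A X"
  shows "is_mp_inverse (std_matrix A) (std_matrix X)"
proof -
  obtain B B0 Y Y0 where [simp]: "A = dual_matrix B B0" "X = dual_matrix Y Y0"
    using dual_matrix_parts by metis
  show ?thesis
    using assms
    by (simp add: is_mp_inverse_def dual_matrix_mult dual_matrix_transpose dual_matrix_eq_iff)
qed

text \<open>The left side is (1 - E X) E0 (1 - X E). The dual part of the first Penrose equation
  splits E0 into terms that begin or end with E, and (1 - E X) E = 0 = E (1 - X E).\<close>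

lemma DMPGI_inf_part:
  fixes E E0 :: "real ^ 'n ^ 'm"
  assumes "has_DMPGI (dual_matrix E E0)" and X: "is_mp_inverse E X"
  shows "E0 - E ** X ** E0 - E0 ** X ** E + E ** X ** E0 ** X ** E = 0"
proof -
  obtain Z where Z: "is_mp_inverse (dual_matrix E E0) Z"
    using assms(1) has_DMPGI_iff by blast
  obtain Y Y0 where ZY: "Z = dual_matrix Y Y0"
    using dual_matrix_parts by metis
  have "Y = X"
    using is_mp_inverse_std_matrix[OF Z] X is_mp_inverse_unique ZY by fastforce
  with Z ZY have E0: "E0 = E ** X ** E0 + (E ** Y0 + E0 ** X) ** E"
    by (simp add: is_mp_inverse_def dual_matrix_mult dual_matrix_eq_iff)
  then have eq: "E0 = E ** X ** E0 + E ** Y0 ** E + E0 ** X ** E"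
    by (simp add: matrix_add_rdistrib add.assoc)
  have EXE: "E ** X ** E = E"
    using X by (simp add: is_mp_inverse_def)
  have "E ** X ** E0 ** X ** E = E ** X ** (E0 ** X ** E)"
    by (simp add: matrix_mul_assoc)
  \<comment> \<open>This is \<open>eq\<close> multiplied by \<open>E ** X\<close> on the left, which
    fixes the terms beginning with E.\<close>
  moreover have "E ** X ** E0 = E ** X ** E0 + E ** Y0 ** E + E ** X ** (E0 ** X ** E)"
  proof -
    have "E ** X ** E0 =
        E ** X ** (E ** X ** E0) + E ** X ** (E ** Y0 ** E) + E ** X ** (E0 ** X ** E)"
      by (subst eq) (simp add: matrix_add_ldistrib)
    also have "E ** X ** (E ** X ** E0) = E ** X ** E0"
      using EXE by (simp add: matrix_mul_assoc)
    also have "E ** X ** (E ** Y0 ** E) = E ** Y0 ** E"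
      using EXE by (simp add: matrix_mul_assoc)
    finally show ?thesis .
  qed
  \<comment> \<open>Here e is E0, the letters a, b, c are the three terms of \<open>eq\<close>, and
    d is \<open>E ** X ** E0 ** X ** E\<close>; the second premise says b + d = 0.\<close>
  moreover have "e - a - c + d = 0" if "e = a + b + c" "a = a + b + d"
    for a b c d e :: "real ^ 'n ^ 'm"
    using that by (simp add: add.assoc)
  ultimately show ?thesis
    using eq by metis
qed

text \<open>Transposing the previous identity gives (1 - X E) E0^T (1 - E X) = 0. The hypotheses
  force X G = 0 and H X = 0, so the outer factor next to G or H acts as the identity. Both are later
  taken to be E - F.\<close>

lemma DMPGI_orthogonal:
  fixes E E0 :: "real ^ 'n ^ 'm" and G :: "real ^ 'p ^ 'm" and H :: "real ^ 'n ^ 'q"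
  assumes E: "has_DMPGI (dual_matrix E E0)" and X: "is_mp_inverse E X"
  shows "transpose E ** G = 0 \<Longrightarrow> X ** E ** transpose E0 ** G = transpose E0 ** G"
    and "H ** transpose E = 0 \<Longrightarrow> H ** transpose E0 ** E ** X = H ** transpose E0"
proof -
  have sym: "transpose (E ** X) = E ** X" "transpose (X ** E) = X ** E"
    using X by (auto simp: is_mp_inverse_def)
  have "transpose (E0 - E ** X ** E0 - E0 ** X ** E + E ** X ** E0 ** X ** E) = 0"
    using DMPGI_inf_part[OF E X] by (simp add: transpose_def vec_eq_iff)
  moreover have "transpose (E ** X ** E0) = transpose E0 ** E ** X"
    "transpose (E0 ** X ** E) = X ** E ** transpose E0"
    "transpose (E ** X ** E0 ** X ** E) = X ** E ** transpose E0 ** E ** X"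
    using sym by (metis matrix_transpose_mul matrix_mul_assoc)+
  moreover have "transpose (A - B - C + D) = transpose A - transpose B - transpose C + transpose D"
    for A B C D :: "real ^ 'n ^ 'm"
    by (simp add: transpose_def vec_eq_iff)
  ultimately have eq: "transpose E0 - transpose E0 ** E ** X - X ** E ** transpose E0 +
      X ** E ** transpose E0 ** E ** X = 0"
    by metis
  show "X ** E ** transpose E0 ** G = transpose E0 ** G" if "transpose E ** G = 0"
  proof -
    have "X ** G = 0"
      using is_mp_inverse_transpose_factor(3)[OF X] that
      by (metis matrix_mul_assoc matrix_mul_rzero)
    \<comment> \<open>Products associate to the left, which hides \<open>X ** G\<close> behind the
      prefix \<open>A\<close>.\<close>
    then have z: "A ** X ** G = 0" for A :: "real ^ 'n ^ 'k"
      by (simp add: matrix_mul_rzero flip: matrix_mul_assoc)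
    show ?thesis
      using arg_cong[OF eq, of "\<lambda>A. A ** G"]
      by (simp add: matrix_add_rdistrib matrix_diff_left z matrix_mul_lzero)
  qed
  show "H ** transpose E0 ** E ** X = H ** transpose E0" if "H ** transpose E = 0"
  proof -
    have "H ** X = 0"
      using is_mp_inverse_transpose_factor(4)[OF X] that
      by (metis matrix_mul_assoc matrix_mul_lzero)
    then show ?thesis
      using arg_cong[OF eq, of "\<lambda>A. H ** A"]
      by (simp add: matrix_add_ldistrib matrix_diff_right matrix_mul_assoc
          matrix_mul_lzero matrix_mul_rzero)
  qed
qed

text \<open>Standard parts give the real star order. The dual parts are sorted so that E0^T meets E
  - F, which the star order makes orthogonal to E.\<close>

lemma D_star_le_dual_matrix:
  "D_star_le (dual_matrix E E0) (dual_matrix F F0) \<longleftrightarrow> star_le E F \<and>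
    transpose E ** (F0 - E0) = transpose E0 ** (E - F) \<and>
    (F0 - E0) ** transpose E = (E - F) ** transpose E0"
  unfolding D_star_le_def star_le_def dual_matrix_transpose dual_matrix_mult dual_matrix_eq_iff
    matrix_diff_left matrix_diff_right
  by (auto simp: algebra_simps)

theorem theorem5p6:
  fixes E E0 F F0 :: "real ^ 'n ^ 'm"
  assumes "has_DMPGI (dual_matrix E E0)"
    and "has_DMPGI (dual_matrix F F0)"
  shows "D_star_le (dual_matrix E E0) (dual_matrix F F0) \<longleftrightarrow>
    DM_star_le (dual_matrix E E0) (dual_matrix F F0) \<and>
    E ** mp_inverse E ** (F0 - E0) = mp_inverse (transpose E) ** transpose E0 ** (E - F) \<and>
    (F0 - E0) ** mp_inverse E ** E = (E - F) ** transpose E0 ** mp_inverse (transpose E)"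
proof -
  obtain Z W where Z: "is_mp_inverse (dual_matrix E E0) Z"
    and W: "is_mp_inverse (dual_matrix F F0) W"
    using assms has_DMPGI_iff by blast
  define X where "X = std_matrix Z"
  have X: "is_mp_inverse E X"
    using is_mp_inverse_std_matrix[OF Z] by (simp add: X_def)
  have mp: "mp_inverse E = X" "mp_inverse (transpose E) = transpose X"
    using X is_mp_inverse_transpose mp_inverse_eqI by blast+
  have sym: "transpose X ** transpose E = E ** X" "transpose E ** transpose X = X ** E"
    using X by (auto simp: is_mp_inverse_def matrix_transpose_mul)
  \<comment> \<open>The witness is \<open>W - Z\<close>, obtained directly over the dual
    numbers.\<close>
  have DM: "has_DMPGI (dual_matrix F F0 - dual_matrix E E0)"
    if "D_star_le (dual_matrix E E0) (dual_matrix F F0)"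
    using that is_mp_inverse_star_le_diff[OF Z W] has_DMPGI_iff by (auto simp: D_star_le_def)
  have left: "transpose E ** (F0 - E0) = transpose E0 ** (E - F) \<longleftrightarrow>
      E ** X ** (F0 - E0) = transpose X ** transpose E0 ** (E - F)" (is "?A \<longleftrightarrow> ?B")
    if "star_le E F"
  proof
    \<comment> \<open>Multiplying on the left by X^T turns E^T into E X.\<close>
    show ?B if ?A
      using that sym(1) by (metis matrix_mul_assoc)
    have "transpose E ** (E - F) = 0"
      using \<open>star_le E F\<close> by (simp add: star_le_def matrix_diff_right)
    then have o: "X ** E ** transpose E0 ** (E - F) = transpose E0 ** (E - F)"
      by (rule DMPGI_orthogonal(1)[OF assms(1) X])
    show ?A if ?B
    proof -
      \<comment> \<open>Since E^T E X = E^T, multiplying \<open>?B\<close> by E^T recovers the left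
        side of \<open>?A\<close>; the right side acquires the factor X E, which \<open>o\<close>
        removes.\<close>
      have "transpose E ** (F0 - E0) = transpose E ** (E ** X ** (F0 - E0))"
        using is_mp_inverse_transpose_factor(1)[OF X] by (simp add: matrix_mul_assoc)
      also have "\<dots> = X ** E ** transpose E0 ** (E - F)"
        unfolding that by (simp add: matrix_mul_assoc sym(2))
      finally show ?A
        by (simp add: o)
    qed
  qed
  have right: "(F0 - E0) ** transpose E = (E - F) ** transpose E0 \<longleftrightarrow>
      (F0 - E0) ** X ** E = (E - F) ** transpose E0 ** transpose X" (is "?A \<longleftrightarrow> ?B")
    if "star_le E F"
  proof
    show ?B if ?A
      using that sym(2) by (metis matrix_mul_assoc)
    have "(E - F) ** transpose E = 0"
      using \<open>star_le E F\<close> by (simp add: star_le_def matrix_diff_left)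
    then have o: "(E - F) ** transpose E0 ** E ** X = (E - F) ** transpose E0"
      by (rule DMPGI_orthogonal(2)[OF assms(1) X])
    show ?A if ?B
    proof -
      have "(F0 - E0) ** transpose E = (F0 - E0) ** X ** E ** transpose E"
        using is_mp_inverse_transpose_factor(2)[OF X] by (metis matrix_mul_assoc)
      also have "\<dots> = (E - F) ** transpose E0 ** (transpose X ** transpose E)"
        unfolding that by (simp add: matrix_mul_assoc)
      finally show ?A
        unfolding sym(1) by (simp add: matrix_mul_assoc o)
    qed
  qed
  show ?thesis
    using DM left right
    by (auto simp: D_star_le_dual_matrix DM_star_le_def mp)
qed

end
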